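(* Let $G$ be a connected graph and $\mathcal{B}$ its set of blocks. Let $\emptyset\ne\mathcal{A}_1,\mathcal{A}_2\subseteq\mathcal{B}$ with $\mathcal{A}_1\ne\mathcal{A}_2$, $G[\mathcal{A}_1]$ and $G[\mathcal{A}_2]$ connected, and $|\mathcal{A}_1|\le|\mathcal{A}_2|$. Then $\{\chi^{\mathcal{A}_1},\chi^{\mathcal{A}_2}\}$ is an edge of $\mathrm{CBP}(G)$ if and only if one of the following conditions holds: (i) $G[\mathcal{A}_1\cup\mathcal{A}_2]$ is disconnected, or (ii) $\mathcal{A}_1\subseteq\mathcal{A}_2$ and there is a unique block in $\mathcal{A}_2\setminus\mathcal{A}_1$ that shares a common vertex with a block of $\mathcal{A}_1$.
   Context: Graphs are finite, simple and undirected. A connected graph is 2-connected if it has at least three vertices and remains connected after deleting any single vertex. A bridge is an edge whose deletion increases the number of connected components. A block of $G$ is a maximal 2-connected subgraph of $G$ or a bridge together with its two end vertices; $\mathcal{B}$ denotes the set of blocks of $G$. For $\mathcal{A}\subseteq\mathcal{B}$ let $G[\mathcal{A}]=\bigcup_{B\in\mathcal{A}}B$ (the empty graph counts as connected), and let $\chi^{\mathcal{A}}\in\{0,1\}^{\mathcal{B}}$ be the incidence vector of $\mathcal{A}$. The connected blocks polytope is $\mathrm{CBP}(G)=\mathrm{conv}\{\chi^{\mathcal{A}}\mid \mathcal{A}\subseteq\mathcal{B},\ G[\mathcal{A}]\text{ connected}\}\subseteq\mathbb{R}^{\mathcal{B}}$. Saying that a pair $\{u,w\}$ of vertices is an edge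 of a polytope means that the segment $\mathrm{conv}\{u,w\}$ is a 1-dimensional face. *)

theory Defs
  imports "HOL-Analysis.Analysis"
begin

text \<open>The prefix \<open>graph_\<close> keeps graph connectivity apart from the topological
  constant \<^const>\<open>connected\<close>.\<close>

datatype 'v graph = Graph (verts: "'v set") (edges: "'v set set")

definition simple_graph :: "'v graph \<Rightarrow> bool" where
  "simple_graph G \<longleftrightarrow> finite (verts G) \<and> (\<forall>e\<in>edges G. e \<subseteq> verts G \<and> card e = 2)"

definition subgraph :: "'v graph \<Rightarrow> 'v graph \<Rightarrow> bool" where
  "subgraph H G \<longleftrightarrow> simple_graph H \<and> verts H \<subseteq> verts G \<and> edges H \<subseteq> edges G"

definition adjacency :: "'v graph \<Rightarrow> ('v \<times> 'v) set" where
  "adjacency G = {(u, v). {u, v} \<in> edges G}"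

definition graph_component :: "'v graph \<Rightarrow> 'v \<Rightarrow> 'v set" where
  "graph_component G u = {v \<in> verts G. (u, v) \<in> (adjacency G)\<^sup>*}"

definition graph_components :: "'v graph \<Rightarrow> 'v set set" where
  "graph_components G = graph_component G ` verts G"

text \<open>The empty graph is connected under this definition.\<close>

definition graph_connected :: "'v graph \<Rightarrow> bool" where
  "graph_connected G \<longleftrightarrow> (\<forall>u\<in>verts G. \<forall>v\<in>verts G. (u, v) \<in> (adjacency G)\<^sup>*)"

definition delete_vertex :: "'v graph \<Rightarrow> 'v \<Rightarrow> 'v graph" where
  "delete_vertex G v = Graph (verts G - {v}) {e \<in> edges G. v \<notin> e}"

definition delete_edge :: "'v graph \<Rightarrow> 'v set \<Rightarrow> 'v graph" where
  "delete_edge G e = Graph (verts G) (edges G - {e})"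

definition two_connected :: "'v graph \<Rightarrow> bool" where
  "two_connected G \<longleftrightarrow> graph_connected G \<and> 3 \<le> card (verts G) \<and>
     (\<forall>v\<in>verts G. graph_connected (delete_vertex G v))"

definition bridge :: "'v graph \<Rightarrow> 'v set \<Rightarrow> bool" where
  "bridge G e \<longleftrightarrow> e \<in> edges G \<and>
     card (graph_components G) < card (graph_components (delete_edge G e))"

definition maximal_two_connected_subgraph :: "'v graph \<Rightarrow> 'v graph \<Rightarrow> bool" where
  "maximal_two_connected_subgraph G H \<longleftrightarrow> subgraph H G \<and> two_connected H \<and>
     (\<forall>H'. subgraph H' G \<and> two_connected H' \<and> subgraph H H' \<longrightarrow> H' = H)"

text \<open>A bridge \<open>e\<close> is its own set of end vertices, so \<open>Graph e {e}\<close> is the bridge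
  together with its two ends.\<close>

definition blocks :: "'v graph \<Rightarrow> 'v graph set" where
  "blocks G = {H. maximal_two_connected_subgraph G H} \<union> {Graph e {e} | e. bridge G e}"

definition graph_Union :: "'v graph set \<Rightarrow> 'v graph" where
  "graph_Union \<A> = Graph (\<Union>B\<in>\<A>. verts B) (\<Union>B\<in>\<A>. edges B)"

text \<open>Vectors indexed by the blocks of \<open>G\<close> are rendered as \<open>real ^ 'b\<close>, where the finite
  type \<open>'b\<close> labels the blocks through a bijection \<open>\<beta>\<close> from \<open>UNIV\<close> onto \<open>blocks G\<close>;
  coordinate \<open>i\<close> belongs to the block \<open>\<beta> i\<close>. Such a labelling exists for a suitable \<open>'b\<close>
  whenever \<open>G\<close> has at least one block.\<close>

definition block_labelling :: "'v graph \<Rightarrow> ('b::finite \<Rightarrow> 'v graph) \<Rightarrow> bool" where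
  "block_labelling G \<beta> \<longleftrightarrow> bij_betw \<beta> UNIV (blocks G)"

definition incidence_vector :: "('b::finite \<Rightarrow> 'v graph) \<Rightarrow> 'v graph set \<Rightarrow> real ^ 'b" where
  "incidence_vector \<beta> \<A> = (\<chi> i. if \<beta> i \<in> \<A> then 1 else 0)"

definition CBP :: "'v graph \<Rightarrow> ('b::finite \<Rightarrow> 'v graph) \<Rightarrow> (real ^ 'b) set" where
  "CBP G \<beta> = convex hull
     {incidence_vector \<beta> \<A> | \<A>. \<A> \<subseteq> blocks G \<and> graph_connected (graph_Union \<A>)}"

end

theory Submission
  imports Defs
begin

text \<open>A block meets the union of a connected set of other blocks in at most one vertex. Hence the
  number of vertices covered by a set \<open>A\<close> of blocks minus \<open>\<Sum>B\<in>A. |B| - 1\<close> counts connected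
  components; since this number is submodular, the intersection of two connected sets with
  connected union is connected. If neither set contains the other, then
  \<open>\<chi>\<^sup>A + \<chi>\<^sup>B = \<chi>\<^sup>A\<^sup>\<union>\<^sup>B + \<chi>\<^sup>A\<^sup>\<inter>\<^sup>B\<close> shows that the pair is not an edge; if \<open>A \<subseteq> B\<close> and two blocks of
  \<open>B - A\<close> touch \<open>A\<close>, splitting \<open>B - A\<close> into two parts attached to \<open>A\<close> gives a similar exchange.
  In the remaining cases an explicit linear functional is maximised exactly at the two
  vertices.\<close>

section \<open>Vertex deletion, nonseparability and cuts of block families\<close>

definition delete_vertices :: "'v graph \<Rightarrow> 'v set \<Rightarrow> 'v graph" where
  "delete_vertices G X = Graph (verts G - X) {e \<in> edges G. e \<inter> X = {}}"

text \<open>Both kinds of block satisfy this: the bound 2 admits a single edge, and the subsets of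
  \<open>{v}\<close> cover deleting nothing as well as deleting one vertex. Letting \<open>v\<close>
  lie outside the graph is harmless, since nothing is deleted then.\<close>

definition nonseparable :: "'v graph \<Rightarrow> bool" where
  "nonseparable H \<longleftrightarrow> simple_graph H \<and> 2 \<le> card (verts H) \<and>
     (\<forall>v X. X \<subseteq> {v} \<longrightarrow> graph_connected (delete_vertices H X))"

abbreviation cover :: "'v graph set \<Rightarrow> 'v set" where
  "cover F \<equiv> \<Union>B\<in>F. verts B"

text \<open>Connectivity of \<open>\<Union>F\<close> after deleting the vertices in \<open>X\<close>, in terms of cuts of the family \<open>F\<close>.\<close>

definition linked :: "'v set \<Rightarrow> 'v graph set \<Rightarrow> bool" where
  "linked X F \<longleftrightarrow>
     (\<forall>S T. S \<union> T = F \<and> S \<inter> T = {} \<and> cover S \<inter> cover T \<subseteq> X \<longrightarrow> S = {} \<or> T = {})"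

lemma linkedD:
  "linked X F \<Longrightarrow> S \<union> T = F \<Longrightarrow> S \<inter> T = {} \<Longrightarrow> cover S \<inter> cover T \<subseteq> X \<Longrightarrow> S = {} \<or> T = {}"
  unfolding linked_def by blast

lemma delete_vertices_empty [simp]: "delete_vertices G {} = G"
  by (cases G) (simp add: delete_vertices_def)

lemma delete_vertices_singleton: "delete_vertices G {v} = delete_vertex G v"
  by (simp add: delete_vertices_def delete_vertex_def)

lemma delete_vertex_notin:
  assumes "simple_graph G" "v \<notin> verts G"
  shows "delete_vertex G v = G"
  using assms by (cases G) (auto simp: delete_vertex_def simple_graph_def)

lemma sym_adjacency: "sym (adjacency G)"
  by (auto simp: sym_def adjacency_def insert_commute)

lemma adjacency_mono: "edges H \<subseteq> edges G \<Longrightarrow> adjacency H \<subseteq> adjacency G"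
  by (auto simp: adjacency_def)

section \<open>Blocks as maximal nonseparable subgraphs\<close>

lemma two_connected_nonseparable:
  assumes "simple_graph H" "two_connected H"
  shows "nonseparable H"
proof -
  have "graph_connected (delete_vertices H X)" if "X \<subseteq> {v}" for X v
  proof (cases "X = {}")
    case True
    then show ?thesis using assms by (simp add: two_connected_def)
  next
    case False
    then have "X = {v}" using that by blast
    then show ?thesis using assms delete_vertex_notin[OF assms(1), of v]
      by (cases "v \<in> verts H") (auto simp: delete_vertices_singleton two_connected_def)
  qed
  then show ?thesis using assms by (auto simp: nonseparable_def two_connected_def)
qed

lemma nonseparable_two_connected:
  assumes "nonseparable H" "3 \<le> card (verts H)"
  shows "two_connected H"
proof -
  have "graph_connected (delete_vertices H {})" "\<And>v. graph_connected (delete_vertices H {v})"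
    using assms(1) unfolding nonseparable_def by blast+
  then show ?thesis using assms(2) by (simp add: two_connected_def delete_vertices_singleton)
qed

text \<open>If the ends remained joined without \<open>e\<close>, every step along \<open>e\<close>
  could be rerouted, so reachability and hence the components would be the same before and after the
  deletion, against the increase in their number.\<close>

lemma bridge_separates:
  assumes "bridge G e" "e = {x, y}"
  shows "(x, y) \<notin> (adjacency (delete_edge G e))\<^sup>*"
proof
  let ?R = "adjacency (delete_edge G e)"
  assume xy: "(x, y) \<in> ?R\<^sup>*"
  then have yx: "(y, x) \<in> ?R\<^sup>*"
    using sym_rtrancl[OF sym_adjacency] by (meson symD)
  have "adjacency G \<subseteq> ?R\<^sup>*"
  proof
    fix p assume p: "p \<in> adjacency G"
    obtain a b where ab: "p = (a, b)" by fastforce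
    show "p \<in> ?R\<^sup>*"
    proof (cases "{a, b} = e")
      case True
      then have "(a = x \<and> b = y) \<or> (a = y \<and> b = x)"
        using assms(2) by (auto simp: doubleton_eq_iff)
      then show ?thesis using xy yx ab by auto
    next
      case False
      then have "p \<in> ?R" using p ab by (auto simp: adjacency_def delete_edge_def)
      then show ?thesis by blast
    qed
  qed
  moreover have "?R \<subseteq> adjacency G"
    by (rule adjacency_mono) (auto simp: delete_edge_def)
  ultimately have "?R\<^sup>* = (adjacency G)\<^sup>*" by (simp add: rtrancl_subset)
  then have "graph_components G = graph_components (delete_edge G e)"
    by (simp add: graph_components_def graph_component_def delete_edge_def)
  then show False using assms(1) by (simp add: bridge_def)
qed

lemma nonseparable_single_edge:
  assumes "card e = 2"
  shows "nonseparable (Graph e {e})"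
proof -
  obtain x y where e: "e = {x, y}" "x \<noteq> y" using assms by (meson card_2_iff)
  have "graph_connected (delete_vertices (Graph e {e}) X)" if "X \<subseteq> {v}" for X v
  proof (cases "X \<inter> e = {}")
    case True
    then have "adjacency (delete_vertices (Graph e {e}) X) = {(x, y), (y, x)}"
      using e by (auto simp: adjacency_def delete_vertices_def doubleton_eq_iff)
    then show ?thesis using e by (auto simp: graph_connected_def delete_vertices_def)
  next
    case False
    then show ?thesis using that e by (auto simp: graph_connected_def delete_vertices_def)
  qed
  moreover have "simple_graph (Graph e {e})"
    using assms by (auto simp: simple_graph_def card_ge_0_finite)
  ultimately show ?thesis using assms by (auto simp: nonseparable_def)
qed

text \<open>A third vertex \<open>z\<close> of \<open>H\<close> would yield a walk from
  \<open>x\<close> to \<open>z\<close> in \<open>H\<close> without \<open>y\<close> and one from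
  \<open>z\<close> to \<open>y\<close> in \<open>H\<close> without \<open>x\<close>. Each omits an
  end of \<open>e\<close>, so together they join \<open>x\<close> and \<open>y\<close> without using
  the bridge.\<close>

lemma bridge_maximal:
  assumes "bridge G e" "subgraph H G" "nonseparable H" "subgraph (Graph e {e}) H"
  shows "H = Graph e {e}"
proof -
  have H: "simple_graph H" using assms(2) by (simp add: subgraph_def)
  have eH: "e \<in> edges H" "e \<subseteq> verts H" using assms(4) by (auto simp: subgraph_def)
  then obtain x y where e: "e = {x, y}" "x \<noteq> y"
    using H by (metis card_2_iff simple_graph_def)
  have "verts H \<subseteq> e"
  proof (rule ccontr)
    assume "\<not> verts H \<subseteq> e"
    then obtain z where z: "z \<in> verts H" "z \<noteq> x" "z \<noteq> y" using e by blast
    have conn: "(a, b) \<in> (adjacency (delete_edge G e))\<^sup>*"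
      if "v \<in> e" "a \<in> verts H - {v}" "b \<in> verts H - {v}" for a b v
    proof -
      have "graph_connected (delete_vertices H {v})"
        using assms(3) by (auto simp: nonseparable_def)
      then have "(a, b) \<in> (adjacency (delete_vertices H {v}))\<^sup>*"
        using that by (auto simp: graph_connected_def delete_vertices_def)
      moreover have "adjacency (delete_vertices H {v}) \<subseteq> adjacency (delete_edge G e)"
        using that assms(2)
        by (intro adjacency_mono) (auto simp: delete_vertices_def delete_edge_def subgraph_def)
      ultimately show ?thesis using rtrancl_mono by blast
    qed
    have "(x, z) \<in> (adjacency (delete_edge G e))\<^sup>*" by (rule conn[of y]) (use e eH z in auto)
    moreover have "(z, y) \<in> (adjacency (delete_edge G e))\<^sup>*"
      by (rule conn[of x]) (use e eH z in auto)
    ultimately show False using bridge_separates[OF assms(1) e(1)] by (meson rtrancl_trans)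
  qed
  then have v: "verts H = e" using eH by blast
  have "f = e" if "f \<in> edges H" for f
  proof (rule card_subset_eq)
    show "finite e" using e by simp
    show "f \<subseteq> e" "card f = card e" using that H v e by (auto simp: simple_graph_def)
  qed
  then have "edges H = {e}" using eH by blast
  then show ?thesis using v by (cases H) simp
qed

lemma block_subgraph:
  assumes "simple_graph G" "B \<in> blocks G"
  shows "subgraph B G"
proof (cases "maximal_two_connected_subgraph G B")
  case False
  then obtain e where "B = Graph e {e}" "bridge G e" using assms(2) by (auto simp: blocks_def)
  then show ?thesis using assms(1)
    by (auto simp: subgraph_def bridge_def simple_graph_def card_ge_0_finite)
qed (simp add: maximal_two_connected_subgraph_def)

lemma block_simple: "simple_graph G \<Longrightarrow> B \<in> blocks G \<Longrightarrow> simple_graph B"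
  using block_subgraph by (auto simp: subgraph_def)

lemma block_nonseparable:
  assumes "simple_graph G" "B \<in> blocks G"
  shows "nonseparable B"
proof (cases "maximal_two_connected_subgraph G B")
  case True
  then show ?thesis
    by (simp add: maximal_two_connected_subgraph_def two_connected_nonseparable subgraph_def)
next
  case False
  then obtain e where "B = Graph e {e}" "bridge G e" using assms(2) by (auto simp: blocks_def)
  then show ?thesis using assms(1)
    by (auto simp: bridge_def simple_graph_def nonseparable_single_edge)
qed

text \<open>Treats both kinds of block alike: a nonseparable graph above a 2-connected one has at
  least three vertices and is itself 2-connected, while above a bridge \<open>bridge_maximal\<close>
  applies.\<close>

lemma block_maximal_nonseparable:
  assumes "simple_graph G" "B \<in> blocks G" "subgraph H G" "nonseparable H" "subgraph B H"
  shows "H = B"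
proof (cases "maximal_two_connected_subgraph G B")
  case True
  have "finite (verts H)" "verts B \<subseteq> verts H" "3 \<le> card (verts B)"
    using assms True
    by (auto simp: subgraph_def simple_graph_def maximal_two_connected_subgraph_def two_connected_def)
  then have "3 \<le> card (verts H)" by (meson card_mono le_trans)
  then have "two_connected H" using assms(4) nonseparable_two_connected by blast
  then show ?thesis using True assms by (auto simp: maximal_two_connected_subgraph_def)
next
  case False
  then obtain e where "B = Graph e {e}" "bridge G e" using assms(2) by (auto simp: blocks_def)
  then show ?thesis using assms bridge_maximal by blast
qed

lemma finite_blocks:
  assumes "simple_graph G"
  shows "finite (blocks G)"
proof -
  have "blocks G \<subseteq> (\<lambda>(V, E). Graph V E) ` (Pow (verts G) \<times> Pow (edges G))"
  proof
    fix B assume "B \<in> blocks G"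
    then have "subgraph B G" using assms block_subgraph by blast
    then show "B \<in> (\<lambda>(V, E). Graph V E) ` (Pow (verts G) \<times> Pow (edges G))"
      by (intro image_eqI[of _ _ "(verts B, edges B)"]) (auto simp: subgraph_def)
  qed
  moreover have "finite (verts G)" "edges G \<subseteq> Pow (verts G)"
    using assms by (auto simp: simple_graph_def)
  then have "finite (verts G)" "finite (edges G)" by (auto intro: finite_subset)
  ultimately show ?thesis by (meson finite_Pow_iff finite_SigmaI finite_imageI finite_subset)
qed

lemma block_verts:
  assumes "simple_graph G" "B \<in> blocks G"
  shows "finite (verts B)" "2 \<le> card (verts B)" "verts B \<noteq> {}"
proof -
  show "finite (verts B)" using block_simple[OF assms] by (simp add: simple_graph_def)
  show "2 \<le> card (verts B)" using block_nonseparable[OF assms] by (simp add: nonseparable_def)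
  then show "verts B \<noteq> {}" by auto
qed

section \<open>Connectivity of a union of blocks as absence of cuts\<close>

text \<open>Every edge of the union lies inside one member of the family, so a walk starting in
  \<open>cover S\<close> can never leave it when the two sides share no vertex.\<close>

lemma connected_imp_linked:
  assumes "\<And>B. B \<in> F \<Longrightarrow> simple_graph B \<and> verts B \<noteq> {}" "graph_connected (graph_Union F)"
  shows "linked {} F"
  unfolding linked_def
proof (intro allI impI, rule ccontr)
  fix S T assume *: "S \<union> T = F \<and> S \<inter> T = {} \<and> cover S \<inter> cover T \<subseteq> {}" "\<not> (S = {} \<or> T = {})"
  then obtain B B' where B: "B \<in> S" "B' \<in> T" by blast
  then have "verts B \<noteq> {}" "verts B' \<noteq> {}" using * assms(1) by blast+
  then obtain u w where uw: "u \<in> cover S" "w \<in> cover T" using B by blast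
  then have "(u, w) \<in> (adjacency (graph_Union F))\<^sup>*"
    using * assms(2) by (auto simp: graph_connected_def graph_Union_def)
  then have "w \<in> cover S"
  proof induction
    case (step a b)
    then obtain B where B: "B \<in> F" "{a, b} \<in> edges B"
      by (auto simp: adjacency_def graph_Union_def)
    then have "a \<in> verts B" "b \<in> verts B" using assms(1)[OF B(1)] by (auto simp: simple_graph_def)
    then show ?case using step * B by blast
  qed (use uw in simp)
  then show False using uw * by blast
qed

text \<open>A member reached from \<open>u\<close> at one vertex outside \<open>X\<close> is reached
  at all of its vertices outside \<open>X\<close>. The reached members therefore form one side of a
  cut whose sides share only vertices of \<open>X\<close>. The case of a singleton \<open>X\<close>
  later gives nonseparability of a union.\<close>

lemma linked_imp_connected:
  assumes "\<And>B. B \<in> F \<Longrightarrow> graph_connected (delete_vertices B X)" "linked X F"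
  shows "graph_connected (delete_vertices (graph_Union F) X)"
proof -
  let ?R = "adjacency (delete_vertices (graph_Union F) X)"
  have "(u, w) \<in> ?R\<^sup>*" if u: "u \<in> cover F - X" and w: "w \<in> cover F - X" for u w
  proof -
    define C where "C = {w. (u, w) \<in> ?R\<^sup>*}"
    define S where "S = {B \<in> F. (verts B - X) \<inter> C \<noteq> {}}"
    have sub: "verts B - X \<subseteq> C" if BS: "B \<in> S" for B
    proof
      fix b assume b: "b \<in> verts B - X"
      obtain a where a: "a \<in> verts B - X" "a \<in> C" "B \<in> F" using BS by (auto simp: S_def)
      then have "(a, b) \<in> (adjacency (delete_vertices B X))\<^sup>*"
        using assms(1) b by (auto simp: graph_connected_def delete_vertices_def)
      moreover have "adjacency (delete_vertices B X) \<subseteq> ?R"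
        using a by (intro adjacency_mono) (auto simp: delete_vertices_def graph_Union_def)
      ultimately have "(a, b) \<in> ?R\<^sup>*" using rtrancl_mono by blast
      then show "b \<in> C" using a C_def by (auto intro: rtrancl_trans)
    qed
    have "cover S \<inter> cover (F - S) \<subseteq> X" using sub by (auto simp: S_def)
    moreover have "u \<in> C" by (simp add: C_def)
    then have "S \<noteq> {}" using u by (auto simp: S_def)
    moreover have "S \<union> (F - S) = F" by (auto simp: S_def)
    ultimately have "F - S = {}" using linkedD[OF assms(2), of S "F - S"] by blast
    then have "w \<in> C" using w sub by blast
    then show ?thesis by (simp add: C_def)
  qed
  then show ?thesis by (simp add: graph_connected_def delete_vertices_def graph_Union_def)
qed

lemma blocks_connected_iff_linked:
  assumes "simple_graph G" "A \<subseteq> blocks G"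
  shows "graph_connected (graph_Union A) \<longleftrightarrow> linked {} A"
proof
  show "graph_connected (graph_Union A) \<Longrightarrow> linked {} A"
    using assms by (intro connected_imp_linked) (auto dest: block_simple block_verts)
  assume "linked {} A"
  moreover have "graph_connected (delete_vertices B {})" if "B \<in> A" for B
    using block_nonseparable[OF assms(1)] assms(2) that unfolding nonseparable_def by blast
  ultimately show "graph_connected (graph_Union A)"
    using linked_imp_connected[of A "{}"] by simp
qed

lemma linked_one_side:
  assumes "linked {} A" "A \<subseteq> S \<union> T" "cover S \<inter> cover T = {}" "S \<inter> T = {}"
  shows "A \<subseteq> S \<or> A \<subseteq> T"
proof -
  have "A \<inter> S = {} \<or> A \<inter> T = {}"
    by (rule linkedD[OF assms(1)]) (use assms in blast)+
  then show ?thesis using assms(2) by blast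
qed

text \<open>A cut with vertex-disjoint sides splits neither \<open>A\<close> nor \<open>B\<close>,
  and a common vertex forbids placing them on opposite sides.\<close>

lemma linked_Un:
  assumes "linked {} A" "linked {} B" "cover A \<inter> cover B \<noteq> {}"
  shows "linked {} (A \<union> B)"
  unfolding linked_def
proof (intro allI impI)
  fix S T assume *: "S \<union> T = A \<union> B \<and> S \<inter> T = {} \<and> cover S \<inter> cover T \<subseteq> {}"
  have "A \<subseteq> S \<or> A \<subseteq> T" "B \<subseteq> S \<or> B \<subseteq> T"
    using linked_one_side[OF assms(1), of S T] linked_one_side[OF assms(2), of S T] * by auto
  moreover have "\<not> (A \<subseteq> S \<and> B \<subseteq> T)" "\<not> (A \<subseteq> T \<and> B \<subseteq> S)"
    using * assms(3) by blast+
  moreover have "S \<union> T = A \<union> B" "S \<inter> T = {}" using * by simp_all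
  ultimately show "S = {} \<or> T = {}" by blast
qed

lemma linked_empty [simp]: "linked {} {}" and linked_singleton [simp]: "linked {} {B}"
  by (auto simp: linked_def Un_singleton_iff)

section \<open>Intersection of a block with a linked family\<close>

text \<open>In a minimal counterexample, \<open>D\<close> together with \<open>A\<close> would be a closed chain of blocks, whose
  union is nonseparable, against the maximality of \<open>D\<close>.\<close>

lemma block_meets_linked_once:
  assumes G: "simple_graph G" and "A \<subseteq> blocks G" "linked {} A" and D: "D \<in> blocks G" and "D \<notin> A"
    and "x \<in> verts D \<inter> cover A" "y \<in> verts D \<inter> cover A"
  shows "x = y"
proof -
  have "finite A" using assms finite_blocks finite_subset by blast
  then show ?thesis using assms(2,3,5-7)
  proof (induction A arbitrary: x y rule: finite_psubset_induct)
    case (psubset A)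
    show ?case
    proof (rule ccontr)
      assume xy: "x \<noteq> y"
      \<comment> \<open>No single vertex \<open>v\<close> cuts off a part \<open>T\<close> from the
        side of \<open>D\<close>: \<open>T\<close> would meet \<open>D\<close> at most in
        \<open>v\<close>, and \<open>S - {D}\<close> would be a smaller linked family that still
        covers both \<open>x\<close> and \<open>y\<close>, against the induction hypothesis.\<close>
      have side: "T = {}" if ST: "S \<union> T = insert D A" "S \<inter> T = {}" "cover S \<inter> cover T \<subseteq> {v}" "D \<in> S"
        for S T v
      proof (rule ccontr)
        assume T: "T \<noteq> {}"
        define S' where "S' = S - {D}"
        have A: "A = S' \<union> T" "S' \<inter> T = {}" using ST psubset.prems by (auto simp: S'_def)
        have c: "cover S' \<subseteq> cover S" "verts D \<subseteq> cover S" using ST by (auto simp: S'_def)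
        have ST': "cover S' \<inter> cover T \<subseteq> {v}" using ST(3) c(1) by blast
        have only_v: "z = v" if "z \<in> verts D" "z \<in> cover T" for z
          using ST(3) c(2) that by blast
        have xy_in: "x \<in> verts D" "x \<in> cover A" "y \<in> verts D" "y \<in> cover A"
          using psubset.prems by blast+
        have cA: "cover A = cover S' \<union> cover T" using A by blast
        have "S' \<noteq> {}"
        proof
          assume "S' = {}"
          then have "cover A = cover T" using cA by simp
          then show False using only_v xy_in xy by metis
        qed
        then have "cover S' \<inter> cover T \<noteq> {}"
          using linkedD[OF psubset.prems(2), of S' T] A T by blast
        then have v: "v \<in> cover S'" using ST' by blast
        \<comment> \<open>If \<open>S'\<close> fell apart into \<open>P\<close> and
          \<open>Q\<close>, linkedness of \<open>A\<close> would make each of them meet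
          \<open>T\<close>. They can do so only in \<open>v\<close>, which would then lie in
          both.\<close>
        have "linked {} S'" unfolding linked_def
        proof (intro allI impI, rule ccontr)
          fix P Q assume *: "P \<union> Q = S' \<and> P \<inter> Q = {} \<and> cover P \<inter> cover Q \<subseteq> {}"
            "\<not> (P = {} \<or> Q = {})"
          have PQ: "cover P \<inter> cover Q = {}" "cover S' = cover P \<union> cover Q" using * by blast+
          have "cover P \<inter> cover (Q \<union> T) \<noteq> {}"
            using linkedD[OF psubset.prems(2), of P "Q \<union> T"] * A by blast
          then have "v \<in> cover P" using PQ ST' by auto
          moreover have "cover Q \<inter> cover (P \<union> T) \<noteq> {}"
            using linkedD[OF psubset.prems(2), of Q "P \<union> T"] * A by blast
          then have "v \<in> cover Q" using PQ ST' by auto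
          ultimately show False using PQ by blast
        qed
        moreover have "x \<in> cover S'" "y \<in> cover S'" using xy_in cA v only_v by auto
        moreover have "S' \<subset> A" "D \<notin> S'" using A T by (auto simp: S'_def)
        ultimately show False using psubset.IH[of S' x y] psubset.prems xy by blast
      qed
      have linked: "linked X (insert D A)" if "X \<subseteq> {v}" for X v
        unfolding linked_def
      proof (intro allI impI)
        fix S T assume *: "S \<union> T = insert D A \<and> S \<inter> T = {} \<and> cover S \<inter> cover T \<subseteq> X"
        then have "D \<in> S \<or> D \<in> T" by blast
        then show "S = {} \<or> T = {}" using side[of S T v] side[of T S v] * that by blast
      qed
      let ?H = "graph_Union (insert D A)"
      have sub: "subgraph B G" "nonseparable B" "B \<in> blocks G" if "B \<in> insert D A" for B
        using that D psubset.prems G by (auto intro: block_subgraph block_nonseparable)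
      have fin: "finite (verts ?H)"
        using sub psubset.hyps by (auto simp: graph_Union_def subgraph_def simple_graph_def)
      have BH: "subgraph B ?H" if "B \<in> insert D A" for B
        using sub(1)[OF that] that by (auto simp: subgraph_def graph_Union_def)
      have "simple_graph ?H" unfolding simple_graph_def
      proof (intro conjI ballI fin)
        fix e assume "e \<in> edges ?H"
        then obtain B where B: "B \<in> insert D A" "e \<in> edges B" by (auto simp: graph_Union_def)
        then have "e \<subseteq> verts B" "card e = 2"
          using sub(1) by (auto simp: subgraph_def simple_graph_def)
        then show "e \<subseteq> verts ?H" "card e = 2" using BH[OF B(1)] by (auto simp: subgraph_def)
      qed
      moreover have "verts ?H \<subseteq> verts G" "edges ?H \<subseteq> edges G"
        using sub(1) unfolding subgraph_def graph_Union_def by auto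
      ultimately have HG: "subgraph ?H G" by (simp add: subgraph_def)
      have "verts D \<subseteq> verts ?H" by (auto simp: graph_Union_def)
      then have "2 \<le> card (verts ?H)"
        using block_verts(2)[OF G D] card_mono[OF fin] le_trans by blast
      moreover have "graph_connected (delete_vertices ?H X)" if "X \<subseteq> {v}" for X v
      proof (rule linked_imp_connected[OF _ linked[OF that]])
        show "graph_connected (delete_vertices B X)" if "B \<in> insert D A" for B
          using sub(2)[OF that] \<open>X \<subseteq> {v}\<close> unfolding nonseparable_def by blast
      qed
      ultimately have "nonseparable ?H" using HG by (auto simp: nonseparable_def subgraph_def)
      \<comment> \<open>Maximality applies to every member of \<open>insert D A\<close>, so all of
        them equal the union and hence each other, contradicting
        \<open>D \<notin> A\<close>.\<close>
      then have "?H = B" if "B \<in> insert D A" for B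
        using block_maximal_nonseparable[OF G sub(3) HG _ BH] that by blast
      moreover obtain B where "B \<in> A" using psubset.prems by blast
      ultimately show False using psubset.prems by (metis insertCI)
    qed
  qed
qed

section \<open>Excess and intersections of linked families\<close>

text \<open>The excess counts the connected components of a set of blocks.\<close>

definition excess :: "'v graph set \<Rightarrow> int" where
  "excess A = int (card (cover A)) - (\<Sum>B\<in>A. int (card (verts B)) - 1)"

text \<open>Inclusion-exclusion is exact for the sums and for the covers of the union. The
  inequality arises because \<open>cover (A \<inter> B)\<close> may be smaller than
  \<open>cover A \<inter> cover B\<close>.\<close>

lemma excess_Un_Int:
  assumes "finite A" "finite B" "\<And>C. C \<in> A \<union> B \<Longrightarrow> finite (verts C)"
  shows "excess (A \<union> B) + excess (A \<inter> B) \<le> excess A + excess B"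
proof -
  have fin: "finite (cover A)" "finite (cover B)" using assms by auto
  have "card (cover (A \<inter> B)) \<le> card (cover A \<inter> cover B)"
    using fin by (intro card_mono) auto
  moreover have "card (cover (A \<union> B)) + card (cover A \<inter> cover B) = card (cover A) + card (cover B)"
    using card_Un_Int[OF fin] by (simp add: UN_Un)
  moreover have "(\<Sum>C\<in>A \<union> B. int (card (verts C)) - 1) + (\<Sum>C\<in>A \<inter> B. int (card (verts C)) - 1) =
      (\<Sum>C\<in>A. int (card (verts C)) - 1) + (\<Sum>C\<in>B. int (card (verts C)) - 1)"
    by (rule sum.union_inter) (use assms in auto)
  ultimately show ?thesis unfolding excess_def by linarith
qed

lemma excess_disjoint:
  assumes "finite S" "finite T" "\<And>C. C \<in> S \<union> T \<Longrightarrow> finite (verts C)"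
    "S \<inter> T = {}" "cover S \<inter> cover T = {}"
  shows "excess (S \<union> T) = excess S + excess T"
proof -
  have "finite (cover S)" "finite (cover T)" using assms by auto
  then have "card (cover (S \<union> T)) = card (cover S) + card (cover T)"
    using assms(5) by (simp add: UN_Un card_Un_disjoint)
  then show ?thesis using assms by (simp add: excess_def sum.union_disjoint)
qed

lemma linked_extend:
  assumes "linked {} A" "S \<subseteq> A" "S \<noteq> {}" "S \<noteq> A"
  obtains D where "D \<in> A - S" "verts D \<inter> cover S \<noteq> {}"
proof -
  have "S \<union> (A - S) = A" "S \<inter> (A - S) = {}" "A - S \<noteq> {}" using assms(2,4) by blast+
  then have "\<not> cover S \<inter> cover (A - S) \<subseteq> {}" using linkedD[OF assms(1)] assms(3) by metis
  then show ?thesis using that by blast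
qed

text \<open>The family is grown from one block. Each attached block \<open>D\<close> shares exactly
  one vertex with what is already there, so it adds \<open>card (verts D) - 1\<close> new vertices,
  which is just what the sum subtracts. A largest subfamily obtained this way must be
  \<open>A\<close>.\<close>

lemma excess_linked:
  assumes G: "simple_graph G" and A: "A \<subseteq> blocks G" "linked {} A" "A \<noteq> {}"
  shows "excess A = 1"
proof -
  have finA: "finite A" using assms finite_blocks finite_subset by blast
  define \<F> where "\<F> = {S. S \<subseteq> A \<and> S \<noteq> {} \<and> linked {} S \<and> excess S = 1}"
  obtain B where "B \<in> A" using A by blast
  then have "{B} \<in> \<F>" by (simp add: \<F>_def excess_def)
  moreover have "finite \<F>" using finA by (simp add: \<F>_def)
  ultimately obtain S where S: "S \<in> \<F>" and max: "\<And>S'. S' \<in> \<F> \<Longrightarrow> S \<subseteq> S' \<Longrightarrow> S = S'"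
    using finite_has_maximal2[of \<F> "{B}"] by blast
  have "S = A"
  proof (rule ccontr)
    assume "S \<noteq> A"
    then obtain D where D: "D \<in> A - S" "verts D \<inter> cover S \<noteq> {}"
      using linked_extend[OF A(2), of S] S by (auto simp: \<F>_def)
    have S': "S \<subseteq> A" "S \<noteq> {}" "linked {} S" "excess S = 1" using S by (auto simp: \<F>_def)
    obtain x where x: "x \<in> verts D \<inter> cover S" using D by blast
    have "verts D \<inter> cover S = {x}"
      using block_meets_linked_once[OF G _ S'(3), of D _ x] S' D A x by blast
    then have "card (verts D \<inter> cover S) = 1" by simp
    moreover have "finite S" "finite (cover S)" "finite (verts D)"
      using S' finA finite_subset D A block_verts(1)[OF G] by blast+
    ultimately have "card (cover (insert D S)) + 1 = card (verts D) + card (cover S)"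
      using card_Un_Int[of "verts D" "cover S"] by simp
    then have "excess (insert D S) = 1"
      using S'(4) \<open>finite S\<close> D by (simp add: excess_def)
    moreover have "linked {} ({D} \<union> S)" using S' D by (intro linked_Un) auto
    ultimately have "insert D S \<in> \<F>" using S' D by (simp add: \<F>_def)
    then show False using max[of "insert D S"] D by blast
  qed
  then show ?thesis using S by (simp add: \<F>_def)
qed

text \<open>Excess is additive along a cut with vertex-disjoint sides, and by induction each
  nonempty side contributes at least 1.\<close>

lemma excess_ge_1:
  assumes G: "simple_graph G" and "A \<subseteq> blocks G" "A \<noteq> {}"
  shows "1 \<le> excess A \<and> (\<not> linked {} A \<longrightarrow> 2 \<le> excess A)"
proof -
  have "finite A" using assms finite_blocks finite_subset by blast
  then show ?thesis using assms(2,3)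
  proof (induction A rule: finite_psubset_induct)
    case (psubset A)
    show ?case
    proof (cases "linked {} A")
      case True
      then show ?thesis using excess_linked[OF G] psubset.prems by simp
    next
      case False
      then obtain S T where ST: "S \<union> T = A" "S \<inter> T = {}" "cover S \<inter> cover T = {}" "S \<noteq> {}" "T \<noteq> {}"
        unfolding linked_def by blast
      then have "excess A = excess S + excess T"
        using excess_disjoint[OF _ _ _ ST(2,3)] psubset block_verts(1)[OF G] by (metis finite_Un subsetD)
      moreover have "S \<subset> A" "T \<subset> A" using ST(1,2,4,5) by blast+
      then have "1 \<le> excess S" "1 \<le> excess T"
        using psubset.IH[of S] psubset.IH[of T] psubset.prems ST(4,5) by auto
      ultimately show ?thesis by linarith
    qed
  qed
qed

lemma linked_Int:
  assumes G: "simple_graph G" and "A \<subseteq> blocks G" "B \<subseteq> blocks G"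
    and "linked {} A" "linked {} B" "linked {} (A \<union> B)"
  shows "linked {} (A \<inter> B)"
proof (cases "A \<inter> B = {}")
  case False
  then have "A \<noteq> {}" "B \<noteq> {}" "A \<union> B \<noteq> {}" "A \<union> B \<subseteq> blocks G" "A \<inter> B \<subseteq> blocks G"
    using assms by blast+
  then have "excess A = 1" "excess B = 1" "excess (A \<union> B) = 1"
    using excess_linked[OF G] assms by blast+
  moreover have "excess (A \<union> B) + excess (A \<inter> B) \<le> excess A + excess B"
    using assms finite_blocks[OF G] block_verts(1)[OF G] finite_subset
    by (intro excess_Un_Int) blast+
  \<comment> \<open>The intersection has excess at most 1 + 1 - 1 = 1, whereas an unlinked one would
    have at least 2.\<close>
  ultimately show ?thesis
    using excess_ge_1[OF G \<open>A \<inter> B \<subseteq> blocks G\<close> False] by linarith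
qed simp

text \<open>\<open>Y\<close> is a maximal linked extension of \<open>A\<close> inside \<open>A'\<close> avoiding \<open>D\<close>: whatever it misses
  is attached to \<open>A\<close> only through \<open>D\<close>.\<close>

lemma linked_split:
  assumes "finite A'" "linked {} A" "linked {} A'" "A \<subseteq> A'" "A \<noteq> {}"
    and D: "D \<in> A' - A" "verts D \<inter> cover A \<noteq> {}"
    and E: "E \<in> A' - A" "verts E \<inter> cover A \<noteq> {}" and "D \<noteq> E"
  obtains Y Z where "linked {} Y" "linked {} Z" "Y \<union> Z = A'" "Y \<inter> Z = A"
    "D \<notin> Y" "E \<in> Y"
proof -
  define \<F> where "\<F> = {Y. insert E A \<subseteq> Y \<and> Y \<subseteq> A' - {D} \<and> linked {} Y}"
  have "linked {} ({E} \<union> A)" using assms by (intro linked_Un) auto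
  then have "insert E A \<in> \<F>" using assms by (auto simp: \<F>_def)
  moreover have "finite \<F>" using assms(1) by (simp add: \<F>_def)
  ultimately obtain Y where Y: "Y \<in> \<F>" and max: "\<And>Y'. Y' \<in> \<F> \<Longrightarrow> Y \<subseteq> Y' \<Longrightarrow> Y = Y'"
    using finite_has_maximal2[of \<F> "insert E A"] by blast
  have Y': "E \<in> Y" "A \<subseteq> Y" "Y \<subseteq> A'" "D \<notin> Y" "linked {} Y" using Y by (auto simp: \<F>_def)
  \<comment> \<open>Any other block touching \<open>Y\<close> could be added to it, against
    maximality.\<close>
  have apart: "verts B \<inter> cover Y = {}" if "B \<in> A' - Y" "B \<noteq> D" for B
  proof (rule ccontr)
    assume "verts B \<inter> cover Y \<noteq> {}"
    then have "linked {} ({B} \<union> Y)" using Y' by (intro linked_Un) auto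
    then have "insert B Y \<in> \<F>" using Y' that by (auto simp: \<F>_def)
    then show False using max[of "insert B Y"] that by blast
  qed
  define Z where "Z = A \<union> (A' - Y)"
  \<comment> \<open>\<open>D\<close> shares a vertex with \<open>A\<close> and so lies in
    \<open>S\<close>. The rest \<open>T\<close> is then apart from \<open>Y\<close> as well, so
    moving \<open>Y\<close> to the side of \<open>S\<close> turns a cut of \<open>Z\<close> into a
    cut of \<open>A'\<close>.\<close>
  have side: "T = {}" if ST: "S \<union> T = Z" "S \<inter> T = {}" "cover S \<inter> cover T = {}" "A \<subseteq> S" for S T
  proof -
    have "D \<in> Z" using D Y' by (simp add: Z_def)
    then have "D \<in> S" using ST D by blast
    then have T: "T \<subseteq> A' - Y" "D \<notin> T" using ST by (auto simp: Z_def)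
    then have "cover Y \<inter> cover T = {}" using apart by blast
    then have "cover (S \<union> Y) \<inter> cover T = {}" using ST by blast
    moreover have "(S \<union> Y) \<union> T = A'" using ST Y' assms(4) by (auto simp: Z_def)
    moreover have "(S \<union> Y) \<inter> T = {}" using ST T by blast
    ultimately have "S \<union> Y = {} \<or> T = {}"
      by (intro linkedD[OF assms(3)]) simp_all
    then show ?thesis using Y' by blast
  qed
  have "linked {} Z" unfolding linked_def
  proof (intro allI impI)
    fix S T assume *: "S \<union> T = Z \<and> S \<inter> T = {} \<and> cover S \<inter> cover T \<subseteq> {}"
    then have "A \<subseteq> S \<or> A \<subseteq> T" by (intro linked_one_side[OF assms(2)]) (auto simp: Z_def)
    then show "S = {} \<or> T = {}"
      using side[of S T] side[of T S] * by (simp add: Un_commute Int_commute) blast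
  qed
  then show ?thesis using that[of Y Z] Y' assms(4) by (auto simp: Z_def)
qed

section \<open>Incidence vectors and criteria for edges of the polytope\<close>

lemma inner_incidence_vector:
  assumes "block_labelling G \<beta>" "A \<subseteq> blocks G"
  shows "(\<chi> i. w (\<beta> i)) \<bullet> incidence_vector \<beta> A = (\<Sum>B\<in>A. w B)"
proof -
  have bij: "bij_betw \<beta> UNIV (blocks G)" using assms(1) by (simp add: block_labelling_def)
  then have fin: "finite (blocks G)" using bij_betw_finite[OF bij] by simp
  have "(\<chi> i. w (\<beta> i)) \<bullet> incidence_vector \<beta> A = (\<Sum>i\<in>UNIV. if \<beta> i \<in> A then w (\<beta> i) else 0)"
    by (auto simp: inner_vec_def incidence_vector_def intro!: sum.cong)
  also have "\<dots> = (\<Sum>B\<in>blocks G. if B \<in> A then w B else 0)"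
    by (rule sum.reindex_bij_betw[OF bij, of "\<lambda>B. if B \<in> A then w B else 0"])
  also have "\<dots> = (\<Sum>B\<in>A. w B)"
    using sum.inter_restrict[OF fin, of w A] assms(2) by (simp add: Int_absorb1)
  finally show ?thesis .
qed

lemma incidence_vector_eq_iff:
  assumes "block_labelling G \<beta>" "A \<subseteq> blocks G" "B \<subseteq> blocks G"
  shows "incidence_vector \<beta> A = incidence_vector \<beta> B \<longleftrightarrow> A = B"
proof
  assume eq: "incidence_vector \<beta> A = incidence_vector \<beta> B"
  have mem: "\<beta> i \<in> A \<longleftrightarrow> \<beta> i \<in> B" for i
    using arg_cong[OF eq, of "\<lambda>x. x $ i"] by (auto simp: incidence_vector_def split: if_splits)
  have "x \<in> A \<longleftrightarrow> x \<in> B" if "x \<in> blocks G" for x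
  proof -
    have "x \<in> range \<beta>" using that assms(1) by (simp add: block_labelling_def bij_betw_def)
    then show ?thesis using mem by auto
  qed
  then show "A = B" using assms(2,3) by blast
qed simp

text \<open>In a coordinate where the end points differ, they are 0 and 1, so the point with
  parameter \<open>u\<close> has entry \<open>u\<close> or \<open>1 - u\<close> there. Being 0 or 1,
  this entry forces \<open>u\<close> to an end of the segment.\<close>

lemma incidence_vector_in_segment:
  assumes "block_labelling G \<beta>" "A \<subseteq> blocks G" "B \<subseteq> blocks G" "C \<subseteq> blocks G"
    and "incidence_vector \<beta> C \<in> closed_segment (incidence_vector \<beta> A) (incidence_vector \<beta> B)"
  shows "C = A \<or> C = B"
proof (cases "A = B")
  case True
  then show ?thesis using assms incidence_vector_eq_iff[OF assms(1)] by simp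
next
  case False
  obtain u where u: "incidence_vector \<beta> C = (1 - u) *\<^sub>R incidence_vector \<beta> A + u *\<^sub>R incidence_vector \<beta> B"
    using assms(5) by (auto simp: in_segment)
  have "incidence_vector \<beta> A \<noteq> incidence_vector \<beta> B"
    using False incidence_vector_eq_iff[OF assms(1)] assms by blast
  then obtain i where "incidence_vector \<beta> A $ i \<noteq> incidence_vector \<beta> B $ i"
    by (meson vec_eq_iff)
  moreover have "incidence_vector \<beta> C $ i = (1 - u) * incidence_vector \<beta> A $ i + u * incidence_vector \<beta> B $ i"
    by (simp add: u)
  ultimately have "u = 0 \<or> u = 1"
    by (auto simp: incidence_vector_def split: if_splits)
  then have "incidence_vector \<beta> C = incidence_vector \<beta> A \<or> incidence_vector \<beta> C = incidence_vector \<beta> B"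
    using u by auto
  then show ?thesis using incidence_vector_eq_iff[OF assms(1)] assms by blast
qed

lemma CBP_linked:
  assumes "simple_graph G"
  shows "CBP G \<beta> = convex hull (incidence_vector \<beta> ` {A. A \<subseteq> blocks G \<and> linked {} A})"
proof -
  have "{incidence_vector \<beta> A | A. A \<subseteq> blocks G \<and> graph_connected (graph_Union A)} =
      incidence_vector \<beta> ` {A. A \<subseteq> blocks G \<and> linked {} A}"
    using blocks_connected_iff_linked[OF assms] by auto
  then show ?thesis by (simp add: CBP_def)
qed

text \<open>The weights define a linear functional; its supporting hyperplane cuts out a face whose
  only generators are the two given vectors.\<close>

lemma CBP_edge_if_supported:
  fixes w :: "'v graph \<Rightarrow> real"
  assumes G: "simple_graph G" "block_labelling G \<beta>"
    and A: "A \<subseteq> blocks G" "linked {} A" and B: "B \<subseteq> blocks G" "linked {} B" and "A \<noteq> B"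
    and w: "(\<Sum>C\<in>A. w C) = b" "(\<Sum>C\<in>B. w C) = b"
    and less: "\<And>C. C \<subseteq> blocks G \<Longrightarrow> linked {} C \<Longrightarrow> C \<noteq> A \<Longrightarrow> C \<noteq> B \<Longrightarrow> (\<Sum>X\<in>C. w X) < b"
  shows "(convex hull {incidence_vector \<beta> A, incidence_vector \<beta> B}) edge_of CBP G \<beta>"
proof -
  let ?V = "incidence_vector \<beta> ` {A. A \<subseteq> blocks G \<and> linked {} A}"
  let ?w = "\<chi> i. w (\<beta> i)"
  let ?H = "{x. ?w \<bullet> x = b}"
  let ?E = "{incidence_vector \<beta> A, incidence_vector \<beta> B}"
  have fin: "finite ?V" using finite_blocks[OF G(1)] by simp
  have val: "?w \<bullet> incidence_vector \<beta> C = (\<Sum>X\<in>C. w X)" if "C \<subseteq> blocks G" for C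
    by (rule inner_incidence_vector[OF G(2) that])
  have "(\<Sum>X\<in>C. w X) \<le> b" if "C \<subseteq> blocks G" "linked {} C" for C
    using w less[OF that] by (cases "C = A"; cases "C = B") auto
  then have "?V \<subseteq> {x. ?w \<bullet> x \<le> b}" using val by auto
  then have "convex hull ?V \<subseteq> {x. ?w \<bullet> x \<le> b}"
    by (intro hull_minimal convex_halfspace_le)
  then have face: "(convex hull ?V \<inter> ?H) face_of convex hull ?V"
    by (intro face_of_Int_supporting_hyperplane_le) auto
  \<comment> \<open>A face of the hull of finitely many points is the hull of some of them, so it
    suffices to find the generators of value \<open>b\<close>.\<close>
  then obtain V' where V': "V' \<subseteq> ?V" "convex hull ?V \<inter> ?H = convex hull V'"
    using face_of_convex_hull_subset[OF finite_imp_compact[OF fin]] by blast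
  have "V' \<subseteq> ?E"
  proof
    fix x assume x: "x \<in> V'"
    then have "x \<in> ?H" using V'(2) hull_inc[of x V' convex] by blast
    moreover obtain C where "C \<subseteq> blocks G" "linked {} C" "x = incidence_vector \<beta> C"
      using V'(1) x by blast
    ultimately show "x \<in> ?E" using val[of C] less[of C] by force
  qed
  then have "convex hull ?V \<inter> ?H \<subseteq> convex hull ?E" using V'(2) by (simp add: hull_mono)
  moreover have "?E \<subseteq> convex hull ?V" using A B by (auto intro!: hull_inc)
  then have "convex hull ?E \<subseteq> convex hull ?V" by (simp add: hull_minimal)
  moreover have "?E \<subseteq> ?H" using val A B w by auto
  then have "convex hull ?E \<subseteq> ?H" by (intro hull_minimal convex_hyperplane)
  ultimately have "convex hull ?V \<inter> ?H = convex hull ?E" by blast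
  then have "convex hull ?E face_of CBP G \<beta>" using face CBP_linked[OF G(1)] by metis
  moreover have "incidence_vector \<beta> A \<noteq> incidence_vector \<beta> B"
    using incidence_vector_eq_iff[OF G(2) A(1) B(1)] \<open>A \<noteq> B\<close> by blast
  then have "aff_dim (convex hull ?E) = 1" by (simp add: aff_dim_convex_hull aff_dim_2)
  ultimately show ?thesis by (simp add: edge_of_def)
qed

text \<open>The two pairs have equal vector sums, hence a common midpoint. It is interior to the
  segment from \<open>C\<close> to \<open>D\<close>, so a face containing it also contains the
  vector of \<open>C\<close>; but the segment from \<open>A\<close> to \<open>B\<close> holds no
  incidence vectors besides its ends.\<close>

lemma not_CBP_edge_if_exchange:
  assumes G: "simple_graph G" "block_labelling G \<beta>"
    and "A \<subseteq> blocks G" "B \<subseteq> blocks G" "A \<noteq> B"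
    and C: "linked {} C" and D: "linked {} D"
    and eq: "C \<union> D = A \<union> B" "C \<inter> D = A \<inter> B" and "C \<noteq> A" "C \<noteq> B"
  shows "\<not> (convex hull {incidence_vector \<beta> A, incidence_vector \<beta> B}) edge_of CBP G \<beta>"
proof
  let ?i = "incidence_vector \<beta>"
  assume "(convex hull {?i A, ?i B}) edge_of CBP G \<beta>"
  then have face: "closed_segment (?i A) (?i B) face_of CBP G \<beta>"
    by (simp add: edge_of_def segment_convex_hull)
  have sub: "C \<subseteq> blocks G" "D \<subseteq> blocks G" using assms by blast+
  have "midpoint (?i C) (?i D) = midpoint (?i A) (?i B)"
  proof -
    have "?i C + ?i D = ?i A + ?i B"
      using eq by (auto simp: vec_eq_iff incidence_vector_def split: if_splits)
    then show ?thesis by (simp add: midpoint_def)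
  qed
  then have "midpoint (?i C) (?i D) \<in> closed_segment (?i A) (?i B)" by simp
  moreover have "C \<noteq> D" using eq \<open>A \<noteq> B\<close> by blast
  then have "?i C \<noteq> ?i D" using incidence_vector_eq_iff[OF G(2)] sub by blast
  then have "midpoint (?i C) (?i D) \<in> open_segment (?i C) (?i D)" by simp
  moreover have "?i C \<in> CBP G \<beta>" "?i D \<in> CBP G \<beta>"
    unfolding CBP_linked[OF G(1)] using sub C D by (auto intro!: hull_inc)
  ultimately have "?i C \<in> closed_segment (?i A) (?i B)"
    using face unfolding face_of_def by blast
  then show False using incidence_vector_in_segment[OF G(2)] assms sub by blast
qed

section \<open>Weights exhibiting the two kinds of edges\<close>

text \<open>The weights make \<open>A\<close> and \<open>B\<close> total 1 each, so a set with a block outside \<open>A \<union> B\<close> totals at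
  most \<open>1 + 1 - 2\<close>.\<close>

lemma CBP_edge_if_disconnected:
  assumes G: "simple_graph G" "block_labelling G \<beta>"
    and A: "A \<subseteq> blocks G" "linked {} A" "A \<noteq> {}" and B: "B \<subseteq> blocks G" "linked {} B" "B \<noteq> {}"
    and AB: "\<not> linked {} (A \<union> B)"
  shows "(convex hull {incidence_vector \<beta> A, incidence_vector \<beta> B}) edge_of CBP G \<beta>"
proof -
  define w :: "_ \<Rightarrow> real" where
    "w X = (if X \<in> A then 1 / card A else if X \<in> B then 1 / card B else - 2)" for X
  have cover: "cover A \<inter> cover B = {}" using AB linked_Un[OF A(2) B(2)] by blast
  have disj: "A \<inter> B = {}"
  proof (rule ccontr)
    assume "A \<inter> B \<noteq> {}"
    then obtain X where "X \<in> A" "X \<in> B" by blast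
    then show False using cover block_verts(3)[OF G(1)] A by blast
  qed
  have fin: "finite A" "finite B" using A B finite_blocks[OF G(1)] finite_subset by blast+
  then have pos: "0 < card A" "0 < card B" using A B by (auto simp: card_gt_0_iff)
  have sumA: "(\<Sum>X\<in>C. w X) = card C / card A" if "C \<subseteq> A" for C
  proof -
    have "(\<Sum>X\<in>C. w X) = (\<Sum>X\<in>C. 1 / card A)" using that by (intro sum.cong) (auto simp: w_def)
    then show ?thesis by simp
  qed
  have sumB: "(\<Sum>X\<in>C. w X) = card C / card B" if "C \<subseteq> B" for C
  proof -
    have "(\<Sum>X\<in>C. w X) = (\<Sum>X\<in>C. 1 / card B)"
      using that disj by (intro sum.cong) (auto simp: w_def)
    then show ?thesis by simp
  qed
  show ?thesis
  proof (rule CBP_edge_if_supported[OF G A(1,2) B(1,2), of w 1])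
    show "A \<noteq> B" using disj A by blast
    show "sum w A = 1" "sum w B = 1" using sumA[of A] sumB[of B] pos by auto
    fix C assume C: "C \<subseteq> blocks G" "linked {} C" "C \<noteq> A" "C \<noteq> B"
    have finC: "finite C" using C finite_blocks[OF G(1)] finite_subset by blast
    show "sum w C < 1"
    proof (cases "C \<subseteq> A \<union> B")
      case True
      \<comment> \<open>A linked family cannot use both of two vertex-disjoint sides, so here
        \<open>C\<close> is a proper part of one of them and its weight stays below 1.\<close>
      have "C \<subseteq> A \<or> C \<subseteq> B" using linked_one_side[OF C(2) True cover disj] .
      then have "C \<subset> A \<or> C \<subset> B" using C by blast
      then show ?thesis
      proof
        assume "C \<subset> A"
        then have "card C < card A" "C \<subseteq> A" using psubset_card_mono[OF fin(1)] by blast+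
        then show ?thesis using sumA[of C] by simp
      next
        assume "C \<subset> B"
        then have "card C < card B" "C \<subseteq> B" using psubset_card_mono[OF fin(2)] by blast+
        then show ?thesis using sumB[of C] by simp
      qed
    next
      case False
      then obtain X where X: "X \<in> C - (A \<union> B)" by blast
      have "sum w C = sum w (C \<inter> A) + (sum w (C \<inter> B) + sum w (C - (A \<union> B)))"
      proof -
        have "(C - A) \<inter> B = C \<inter> B" "C - A - B = C - (A \<union> B)" using disj by blast+
        then show ?thesis
          using sum.Int_Diff[OF finC, of w A] sum.Int_Diff[of "C - A" w B] finC by simp
      qed
      moreover have "sum w (C \<inter> A) \<le> 1" "sum w (C \<inter> B) \<le> 1"
        using sumA[of "C \<inter> A"] sumB[of "C \<inter> B"] pos fin by (auto simp: card_mono)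
      moreover have "sum w (C - (A \<union> B)) = - 2 * card (C - (A \<union> B))"
      proof -
        have "sum w (C - (A \<union> B)) = (\<Sum>X\<in>C - (A \<union> B). - 2)"
          by (intro sum.cong) (auto simp: w_def)
        then show ?thesis by simp
      qed
      moreover have "0 < card (C - (A \<union> B))" using X finC by (auto simp: card_gt_0_iff)
      ultimately show ?thesis by simp
    qed
  qed
qed

text \<open>The weight \<open>n + 1\<close> forces \<open>A \<subseteq> C \<subseteq> B\<close> for a maximiser \<open>C\<close>; then \<open>C = A\<close>, or \<open>C\<close> contains \<open>D\<close>
  at cost \<open>n\<close>, which is recovered only by all \<open>n\<close> blocks of \<open>R\<close>.\<close>

lemma CBP_edge_if_unique_attachment:
  assumes G: "simple_graph G" "block_labelling G \<beta>"
    and A: "A \<subseteq> blocks G" "linked {} A" "A \<noteq> {}" and B: "B \<subseteq> blocks G" "linked {} B"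
    and AB: "A \<subseteq> B" "A \<noteq> B"
    and D: "D \<in> B - A" "\<And>X. X \<in> B - A \<Longrightarrow> verts X \<inter> cover A \<noteq> {} \<Longrightarrow> X = D"
  shows "(convex hull {incidence_vector \<beta> A, incidence_vector \<beta> B}) edge_of CBP G \<beta>"
proof -
  define R where "R = B - A - {D}"
  define n where "n = real (card R)"
  define w :: "_ \<Rightarrow> real" where
    "w X = (if X \<in> A then n + 1 else if X = D then - n else if X \<in> B then 1 else - (n + 1))" for X
  have fin: "finite A" "finite B" "finite R"
    using A B finite_blocks[OF G(1)] finite_subset unfolding R_def by blast+
  have n: "0 \<le> n" by (simp add: n_def)
  have sum: "sum w C = (n + 1) * card (C \<inter> A) + ((if D \<in> C then - n else 0) +
      (real (card (C \<inter> R)) - (n + 1) * card (C - B)))" if "finite C" for C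
  proof -
    have "(C - A) \<inter> {D} = C \<inter> {D}" "(C - A - {D}) \<inter> B = C \<inter> R" "C - A - {D} - B = C - B"
      using D(1) AB(1) by (auto simp: R_def)
    then have "sum w C = sum w (C \<inter> A) + (sum w (C \<inter> {D}) + (sum w (C \<inter> R) + sum w (C - B)))"
      using sum.Int_Diff[OF that, of w A] sum.Int_Diff[of "C - A" w "{D}"]
        sum.Int_Diff[of "C - A - {D}" w B] that by simp
    also have "sum w (C \<inter> A) = (\<Sum>X\<in>C \<inter> A. n + 1)" by (intro sum.cong) (auto simp: w_def)
    also have "sum w (C \<inter> {D}) = (if D \<in> C then - n else 0)" using D by (auto simp: w_def)
    also have "sum w (C \<inter> R) = (\<Sum>X\<in>C \<inter> R. 1)" by (intro sum.cong) (auto simp: w_def R_def)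
    also have "sum w (C - B) = (\<Sum>X\<in>C - B. - (n + 1))"
      using D AB by (intro sum.cong) (auto simp: w_def)
    finally show ?thesis by (simp add: algebra_simps)
  qed
  show ?thesis
  proof (rule CBP_edge_if_supported[OF G A(1,2) B(1,2) AB(2), of w "(n + 1) * card A"])
    have AR: "A \<inter> R = {}" "A - B = {}" using AB by (auto simp: R_def)
    show "sum w A = (n + 1) * card A" unfolding sum[OF fin(1)] AR using D(1) by simp
    have "B \<inter> R = R" "B \<inter> A = A" using AB by (auto simp: R_def)
    then show "sum w B = (n + 1) * card A" using sum[OF fin(2)] D(1) by (simp add: n_def)
    fix C assume C: "C \<subseteq> blocks G" "linked {} C" "C \<noteq> A" "C \<noteq> B"
    have finC: "finite C" using C finite_blocks[OF G(1)] finite_subset by blast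
    have R: "card (C \<inter> R) \<le> n" using fin by (simp add: n_def card_mono)
    have A': "card (C \<inter> A) \<le> card A" using fin by (simp add: card_mono)
    show "sum w C < (n + 1) * card A"
    proof (cases "A \<subseteq> C \<and> C \<subseteq> B")
      case True
      \<comment> \<open>Since \<open>C\<close> is linked and strictly larger than \<open>A\<close>,
        some block of \<open>C - A\<close> touches \<open>A\<close>; as \<open>C\<close> lies within
        \<open>B\<close>, that block is \<open>D\<close>.\<close>
      then obtain X where X: "X \<in> C - A" "verts X \<inter> cover A \<noteq> {}"
        using linked_extend[OF C(2), of A] C A by metis
      then have DC: "D \<in> C" using D(2)[of X] True by blast
      \<comment> \<open>\<open>C\<close> contains \<open>A\<close> and \<open>D\<close>, so
        differing from \<open>B\<close> means missing a block of \<open>R\<close>; the cost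
        \<open>n\<close> of \<open>D\<close> is not recovered.\<close>
      have "C \<inter> R \<subset> R" using True C DC AB by (auto simp: R_def)
      then have "card (C \<inter> R) < n" using fin psubset_card_mono by (auto simp: n_def)
      moreover have CB: "C - B = {}" "C \<inter> A = A" using True by blast+
      ultimately show ?thesis unfolding sum[OF finC] CB using DC by simp
    next
      case False
      \<comment> \<open>\<open>C\<close> misses a block of \<open>A\<close> or has a block outside
        \<open>B\<close>. Either costs at least \<open>n + 1\<close>, while \<open>R\<close> can
        contribute at most \<open>n\<close>.\<close>
      have "real (card (C \<inter> A)) + 1 \<le> card A + card (C - B)"
      proof (cases "A \<subseteq> C")
        case True
        then have "0 < card (C - B)" using False finC by (auto simp: card_gt_0_iff)
        then show ?thesis using A' by linarith
      next
        case False
        then have "C \<inter> A \<subset> A" by blast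
        then have "card (C \<inter> A) < card A" using fin psubset_card_mono by blast
        then show ?thesis by linarith
      qed
      then have "(n + 1) * (real (card (C \<inter> A)) + 1) \<le> (n + 1) * (real (card A) + card (C - B))"
        using n by (intro mult_left_mono) auto
      then have "(n + 1) * card (C \<inter> A) + (n + 1) \<le> (n + 1) * card A + (n + 1) * card (C - B)"
        by (simp add: algebra_simps)
      moreover have "sum w C \<le> (n + 1) * card (C \<inter> A) + (n - (n + 1) * card (C - B))"
        using sum[OF finC] R n by auto
      ultimately show ?thesis by linarith
    qed
  qed
qed

section \<open>Combination of the cases\<close>

theorem theorem6p2:
  fixes G :: "'v graph" and \<beta> :: "'b::finite \<Rightarrow> 'v graph" and \<A>\<^sub>1 \<A>\<^sub>2 :: "'v graph set"
  assumes "simple_graph G" and "graph_connected G"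
    and "block_labelling G \<beta>"
    and "\<A>\<^sub>1 \<subseteq> blocks G" and "\<A>\<^sub>2 \<subseteq> blocks G"
    and "\<A>\<^sub>1 \<noteq> {}" and "\<A>\<^sub>2 \<noteq> {}" and "\<A>\<^sub>1 \<noteq> \<A>\<^sub>2"
    and "graph_connected (graph_Union \<A>\<^sub>1)" and "graph_connected (graph_Union \<A>\<^sub>2)"
    and "card \<A>\<^sub>1 \<le> card \<A>\<^sub>2"
  shows "(convex hull {incidence_vector \<beta> \<A>\<^sub>1, incidence_vector \<beta> \<A>\<^sub>2}) edge_of CBP G \<beta> \<longleftrightarrow>
    \<not> graph_connected (graph_Union (\<A>\<^sub>1 \<union> \<A>\<^sub>2)) \<or>
    \<A>\<^sub>1 \<subseteq> \<A>\<^sub>2 \<and> (\<exists>!B. B \<in> \<A>\<^sub>2 - \<A>\<^sub>1 \<and> (\<exists>C\<in>\<A>\<^sub>1. verts B \<inter> verts C \<noteq> {}))"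
    (is "?edge \<longleftrightarrow> ?disc \<or> _ \<and> (\<exists>!B. ?attached B)")
proof -
  note iff = blocks_connected_iff_linked[OF \<open>simple_graph G\<close>]
  have A1: "linked {} \<A>\<^sub>1" and A2: "linked {} \<A>\<^sub>2" using assms iff by blast+
  have fin: "finite \<A>\<^sub>1" "finite \<A>\<^sub>2"
    using assms finite_blocks finite_subset by blast+
  have un: "?disc \<longleftrightarrow> \<not> linked {} (\<A>\<^sub>1 \<union> \<A>\<^sub>2)" using assms iff by simp
  have attached: "?attached B \<longleftrightarrow> B \<in> \<A>\<^sub>2 - \<A>\<^sub>1 \<and> verts B \<inter> cover \<A>\<^sub>1 \<noteq> {}" for B by blast
  consider "?disc" | "\<not> ?disc" "\<not> \<A>\<^sub>1 \<subseteq> \<A>\<^sub>2" | "\<not> ?disc" "\<A>\<^sub>1 \<subseteq> \<A>\<^sub>2" by blast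
  then show ?thesis
  proof cases
    case 1
    then have "?edge" using CBP_edge_if_disconnected assms A1 A2 un by blast
    then show ?thesis using 1 by blast
  next
    case 2
    then have l: "linked {} (\<A>\<^sub>1 \<union> \<A>\<^sub>2)" using un by blast
    \<comment> \<open>The cardinality assumption enters here:
      \<open>\<A>\<^sub>2 \<subseteq> \<A>\<^sub>1\<close> would force equality. So the union
      differs from both families, and union and intersection form a genuine exchange pair.\<close>
    have "\<A>\<^sub>1 \<union> \<A>\<^sub>2 \<noteq> \<A>\<^sub>1" using assms fin by (metis card_seteq sup.absorb_iff1)
    moreover have "\<A>\<^sub>1 \<union> \<A>\<^sub>2 \<noteq> \<A>\<^sub>2" using 2 by blast
    moreover have "linked {} (\<A>\<^sub>1 \<inter> \<A>\<^sub>2)" using linked_Int[OF assms(1,4,5) A1 A2 l] .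
    ultimately have "\<not> ?edge"
      by (intro not_CBP_edge_if_exchange[OF assms(1,3,4,5,8) l]) auto
    then show ?thesis using 2 by blast
  next
    case 3
    \<comment> \<open>An attached block always exists, so uniqueness can fail only through a second
      one.\<close>
    obtain D where D: "D \<in> \<A>\<^sub>2 - \<A>\<^sub>1" "verts D \<inter> cover \<A>\<^sub>1 \<noteq> {}"
      using linked_extend[OF A2 3(2)] assms by blast
    show ?thesis
    proof (cases "\<exists>!B. ?attached B")
      case True
      then have "X = D" if "X \<in> \<A>\<^sub>2 - \<A>\<^sub>1" "verts X \<inter> cover \<A>\<^sub>1 \<noteq> {}" for X
        using that D attached by metis
      then have "?edge"
        using CBP_edge_if_unique_attachment[OF assms(1,3,4) A1 assms(6,5) A2 3(2) assms(8) D(1)]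
        by blast
      then show ?thesis using True 3 by blast
    next
      case False
      then obtain E where E: "E \<in> \<A>\<^sub>2 - \<A>\<^sub>1" "verts E \<inter> cover \<A>\<^sub>1 \<noteq> {}" "D \<noteq> E"
        using D attached by metis
      then obtain Y Z where YZ: "linked {} Y" "linked {} Z" "Y \<union> Z = \<A>\<^sub>2" "Y \<inter> Z = \<A>\<^sub>1"
        "D \<notin> Y" "E \<in> Y"
        using linked_split[OF fin(2) A1 A2 3(2) assms(6) D E] by blast
      \<comment> \<open>\<open>Y\<close> contains \<open>E\<close> but not \<open>D\<close>, hence
        lies strictly between the two families. Together with \<open>Z\<close> it has their union
        and their intersection, as the exchange requires.\<close>
      have "Y \<noteq> \<A>\<^sub>1" "Y \<noteq> \<A>\<^sub>2" using YZ D E by blast+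
      then have "\<not> ?edge"
        using not_CBP_edge_if_exchange[OF assms(1,3,4,5,8) YZ(1,2)] YZ 3 by blast
      then show ?thesis using False 3 by blast
    qed
  qed
qed

end
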